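(* Let $A\in\mathbb{R}^{n\times n}$ be a non-singular matrix. (a) Define matrices $M_i,N_i$ ($0\le i\le n$) recursively by $M_0+N_0=A$ and $M_{i+1}+N_{i+1}=I+N_i^{-1}M_i$ for $0\le i<n$, where at each step $M_i$ is the strictly lower (respectively, strictly upper) triangular part of the matrix being split and $N_i$ is its complementary upper (respectively, lower) triangular part, including the diagonal (the same choice of lower/upper being made at all steps). Assume that the matrices $N_i$, $0\le i\le n$, are all invertible. Then $$A=\Big(\prod_{i=0}^{n}N_i\Big)\,(I+N_n^{-1}M_n),\qquad \prod_{i=0}^{n}N_i:=N_0N_1\cdots N_n .$$ (b) Symmetrically, define $M_i,N_i$ ($0\le i\le n$) recursively by $M_0+N_0=A$ and $M_{i+1}+N_{i+1}=I+M_i^{-1}N_i$ for $0\le i<n$, where at each step $M_i$ is the lower (respectively, upper) triangular part, including the diagonal, of the matrix being split and $N_i$ is its complementary strictly upper (respectively, strictly lower) triangular part (the same choice being made at all steps). Assume that the matrices $M_i$, $0\le i\le n$, are all invertible. Then $$A=\Big(\prod_{i=0}^{n}M_i\Big)\,(I+M_n^{-1}N_n),\qquad \prod_{i=0}^{n}M_i:=M_0M_1\cdots M_n .$$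
   Context: $I$ denotes the $n\times n$ identity matrix. The strictly lower (upper) triangular part of a square matrix $X$ is obtained by replacing all entries on and above (below) the diagonal by zero; the lower (upper) triangular part including the diagonal is obtained by replacing all entries strictly above (below) the diagonal by zero. *)

theory Defs
  imports "Jordan_Normal_Form.Gauss_Jordan_Elimination"
begin

definition strictly_lower_part :: "'a::zero mat \<Rightarrow> 'a mat" where
  "strictly_lower_part X =
     mat (dim_row X) (dim_col X) (\<lambda>(i,j). if j < i then X $$ (i,j) else 0)"

definition strictly_upper_part :: "'a::zero mat \<Rightarrow> 'a mat" where
  "strictly_upper_part X =
     mat (dim_row X) (dim_col X) (\<lambda>(i,j). if i < j then X $$ (i,j) else 0)"

definition lower_part :: "'a::zero mat \<Rightarrow> 'a mat" where
  "lower_part X =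
     mat (dim_row X) (dim_col X) (\<lambda>(i,j). if j \<le> i then X $$ (i,j) else 0)"

definition upper_part :: "'a::zero mat \<Rightarrow> 'a mat" where
  "upper_part X =
     mat (dim_row X) (dim_col X) (\<lambda>(i,j). if i \<le> j then X $$ (i,j) else 0)"

text \<open>The splitting of \<open>X\<close> as \<open>M + N\<close>, where \<open>P\<close> and \<open>Q\<close> say which triangular parts are taken.
  For complementary \<open>P\<close> and \<open>Q\<close> the equation \<open>M + N = X\<close> is automatic; see
  \<open>splitting_iff\<close>.\<close>

definition splitting ::
  "('a mat \<Rightarrow> 'a mat) \<Rightarrow> ('a mat \<Rightarrow> 'a mat) \<Rightarrow> 'a::plus mat \<Rightarrow> 'a mat \<Rightarrow> 'a mat \<Rightarrow> bool" where
  "splitting P Q X M N \<longleftrightarrow> M + N = X \<and> M = P X \<and> N = Q X"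

lemma splitting_iff:
  fixes X :: "'a::monoid_add mat"
  assumes "(P, Q) \<in> {(strictly_lower_part, upper_part), (strictly_upper_part, lower_part),
                      (lower_part, strictly_upper_part), (upper_part, strictly_lower_part)}"
  shows "splitting P Q X M N \<longleftrightarrow> M = P X \<and> N = Q X"
proof -
  have "P X + Q X = X"
    using assms
    by (auto simp: strictly_lower_part_def strictly_upper_part_def lower_part_def upper_part_def)
  then show ?thesis
    by (auto simp: splitting_def)
qed

text \<open>\<open>mat_inverse\<close> is an \<open>option\<close>; the value below is meaningful only for invertible matrices.\<close>

definition inv_mat :: "'a::field mat \<Rightarrow> 'a mat" where
  "inv_mat X = the (mat_inverse X)"

lemma inv_mat:
  assumes X: "X \<in> carrier_mat n n" and inv: "invertible_mat X"
  shows "inv_mat X \<in> carrier_mat n n" "X * inv_mat X = 1\<^sub>m n" "inv_mat X * X = 1\<^sub>m n"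
proof -
  obtain B where B: "X * B = 1\<^sub>m n" "B * X = 1\<^sub>m (dim_row B)"
    using inv X by (auto simp: invertible_mat_def inverts_mat_def)
  have "dim_col B = n" "dim_row B = n"
    using arg_cong[OF B(1), of dim_col] arg_cong[OF B(2), of dim_col] X by auto
  then have "X \<in> Units (ring_mat TYPE('a) n ())"
    using B X by (auto simp: Units_def ring_mat_def intro!: bexI[of _ B])
  then obtain C where "mat_inverse X = Some C"
    using mat_inverse(1)[OF X, where b = "()"] by (cases "mat_inverse X") auto
  then show "inv_mat X \<in> carrier_mat n n" "X * inv_mat X = 1\<^sub>m n" "inv_mat X * X = 1\<^sub>m n"
    using mat_inverse(2)[OF X] by (auto simp: inv_mat_def)
qed

text \<open>The ordered product \<open>F 0 * F 1 * \<dots> * F k\<close> of \<open>n \<times> n\<close> matrices.\<close>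

definition mat_prod_upto :: "nat \<Rightarrow> (nat \<Rightarrow> 'a::semiring_1 mat) \<Rightarrow> nat \<Rightarrow> 'a mat" where
  "mat_prod_upto n F k = foldr (*) (map F [0..<Suc k]) (1\<^sub>m n)"

end

theory Submission
  imports Defs
begin

text \<open>If \<open>X = D + R\<close> with \<open>D\<close> invertible, then \<open>X = D * (1 + D\<inverse> * R)\<close>. Each splitting step
  applies this to the last factor of the previous one, so the product telescopes.\<close>

text \<open>The product is a right-nested \<open>foldr\<close> ending in the identity, so a new last
  factor enters at the innermost position. Moving it to the far right takes associativity, which
  holds only for matching dimensions; hence the carrier assumption on every factor.\<close>

lemma mat_prod_upto_Suc:
  assumes "\<And>i. i \<le> Suc k \<Longrightarrow> F i \<in> carrier_mat n n"
  shows "mat_prod_upto n F (Suc k) = mat_prod_upto n F k * F (Suc k)"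
    and "mat_prod_upto n F k \<in> carrier_mat n n"
proof -
  \<comment> \<open>The seed \<open>Y\<close> is generalised: a right fold started at
    \<open>Y\<close> is the fold started at the identity, times \<open>Y\<close>. The carrier claim
    joins the induction because \<open>assoc_mult_mat\<close> needs it for the tail. Taking
    \<open>Y\<close> to be \<open>F (Suc k)\<close> gives the recursion.\<close>
  have fold: "foldr (*) (map F is) Y = foldr (*) (map F is) (1\<^sub>m n) * Y \<and>
      foldr (*) (map F is) (1\<^sub>m n) \<in> carrier_mat n n"
    if "\<forall>i\<in>set is. i \<le> Suc k" "Y \<in> carrier_mat n n" for "is" Y
    using that(1)
  proof (induction "is")
    case Nil
    then show ?case using that(2) by simp
  next
    case (Cons i "is")
    then have "F i \<in> carrier_mat n n" using assms by simp
    with Cons that(2) show ?case by (auto simp: assoc_mult_mat[of _ n n _ n _ n])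
  qed
  show "mat_prod_upto n F (Suc k) = mat_prod_upto n F k * F (Suc k)"
    using fold[of "[0..<Suc k]" "F (Suc k)"] assms[of "Suc k"] by (simp add: mat_prod_upto_def)
  show "mat_prod_upto n F k \<in> carrier_mat n n"
    using fold[of "[0..<Suc k]" "1\<^sub>m n"] by (simp add: mat_prod_upto_def)
qed

lemma factor_left_summand:
  assumes D: "D \<in> carrier_mat n n" and R: "R \<in> carrier_mat n n" and inv: "invertible_mat D"
  shows "D + R = D * (1\<^sub>m n + inv_mat D * R)"
proof -
  note I = inv_mat[OF D inv]
  have "D * (1\<^sub>m n + inv_mat D * R) = D + D * (inv_mat D * R)"
    using mult_add_distrib_mat[OF D one_carrier_mat mult_carrier_mat[OF I(1) R]] D by simp
  also have "D * (inv_mat D * R) = R"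
    using assoc_mult_mat[OF D I(1) R] I(2) R by simp
  finally show ?thesis by simp
qed

text \<open>The telescoping, stated for arbitrary summands so that it serves both parts:
  \<open>D\<close> is the invertible summand, namely \<open>N\<close> in (a) and \<open>M\<close> in
  (b). The step count \<open>k\<close> is kept apart from the size \<open>n\<close>, so the
  induction on \<open>k\<close> leaves the dimension fixed.\<close>

lemma iterated_splitting_product:
  assumes D: "\<And>i. i \<le> k \<Longrightarrow> D i \<in> carrier_mat n n"
    and R: "\<And>i. i \<le> k \<Longrightarrow> R i \<in> carrier_mat n n"
    and inv: "\<And>i. i \<le> k \<Longrightarrow> invertible_mat (D i)"
    and step: "\<And>i. i < k \<Longrightarrow> D (Suc i) + R (Suc i) = 1\<^sub>m n + inv_mat (D i) * R i"
  shows "D 0 + R 0 = mat_prod_upto n D k * (1\<^sub>m n + inv_mat (D k) * R k)"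
  using assms
proof (induction k)
  case 0
  then show ?case
    using factor_left_summand[of "D 0" n "R 0"] by (simp add: mat_prod_upto_def)
next
  case (Suc k)
  note P = mat_prod_upto_Suc[of k D n, OF Suc.prems(1)]
  have Dk: "D (Suc k) \<in> carrier_mat n n" and Rk: "R (Suc k) \<in> carrier_mat n n"
    and ik: "invertible_mat (D (Suc k))"
    using Suc.prems by auto
  have Z: "1\<^sub>m n + inv_mat (D (Suc k)) * R (Suc k) \<in> carrier_mat n n"
    using inv_mat(1)[OF Dk ik] Rk by simp
  have "D 0 + R 0 = mat_prod_upto n D k * (1\<^sub>m n + inv_mat (D k) * R k)"
    using Suc by simp
  \<comment> \<open>The trailing factor left after \<open>k\<close> steps is exactly the matrix
    split at step \<open>Suc k\<close>.\<close>
  also have "1\<^sub>m n + inv_mat (D k) * R k = D (Suc k) + R (Suc k)"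
    using Suc.prems(4)[of k] by simp
  also have "\<dots> = D (Suc k) * (1\<^sub>m n + inv_mat (D (Suc k)) * R (Suc k))"
    by (rule factor_left_summand[OF Dk Rk ik])
  finally show ?case
    using P assoc_mult_mat[OF P(2) Dk Z] by simp
qed

lemma triangular_part_carrier:
  assumes "X \<in> carrier_mat n n"
    and "P \<in> {strictly_lower_part, strictly_upper_part, lower_part, upper_part}"
  shows "P X \<in> carrier_mat n n"
  using assms
  by (auto simp: strictly_lower_part_def strictly_upper_part_def lower_part_def upper_part_def)

text \<open>Only \<open>A\<close> is known to be n by n at the start, so dimensions are propagated
  along the recursion; \<open>X i\<close> is the matrix split at step \<open>i\<close>. The
  assumption \<open>step\<close> is conditional because the size of an inverse follows only from the
  size of the matrix inverted.\<close>

lemma iterated_splitting_carrier: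
  assumes parts: "P \<in> {strictly_lower_part, strictly_upper_part, lower_part, upper_part}"
      "Q \<in> {strictly_lower_part, strictly_upper_part, lower_part, upper_part}"
    and "X 0 \<in> carrier_mat n n"
    and split: "\<And>i. i \<le> k \<Longrightarrow> splitting P Q (X i) (M i) (N i)"
    and step: "\<And>i. i < k \<Longrightarrow> M i \<in> carrier_mat n n \<Longrightarrow> N i \<in> carrier_mat n n \<Longrightarrow>
      X (Suc i) \<in> carrier_mat n n"
    and "i \<le> k"
  shows "M i \<in> carrier_mat n n \<and> N i \<in> carrier_mat n n"
  using \<open>i \<le> k\<close>
proof (induction i)
  case 0
  then show ?case
    using split[of 0] assms(3) parts triangular_part_carrier by (auto simp: splitting_def)
next
  case (Suc i)
  then have "X (Suc i) \<in> carrier_mat n n" using step by simp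
  then show ?case
    using split[OF Suc.prems] parts[THEN triangular_part_carrier[rotated]]
    by (simp add: splitting_def)
qed

theorem theorem5p1:
  fixes A :: "real mat" and n :: nat
  assumes "A \<in> carrier_mat n n" and "invertible_mat A"
  shows
    "(\<forall>P Q. \<forall>M N :: nat \<Rightarrow> real mat.
        (P, Q) \<in> {(strictly_lower_part, upper_part), (strictly_upper_part, lower_part)} \<longrightarrow>
        splitting P Q A (M 0) (N 0) \<longrightarrow>
        (\<forall>i<n. splitting P Q (1\<^sub>m n + inv_mat (N i) * M i) (M (Suc i)) (N (Suc i))) \<longrightarrow>
        (\<forall>i\<le>n. invertible_mat (N i)) \<longrightarrow>
        A = mat_prod_upto n N n * (1\<^sub>m n + inv_mat (N n) * M n))
   \<and> (\<forall>P Q. \<forall>M N :: nat \<Rightarrow> real mat.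
        (P, Q) \<in> {(lower_part, strictly_upper_part), (upper_part, strictly_lower_part)} \<longrightarrow>
        splitting P Q A (M 0) (N 0) \<longrightarrow>
        (\<forall>i<n. splitting P Q (1\<^sub>m n + inv_mat (M i) * N i) (M (Suc i)) (N (Suc i))) \<longrightarrow>
        (\<forall>i\<le>n. invertible_mat (M i)) \<longrightarrow>
        A = mat_prod_upto n M n * (1\<^sub>m n + inv_mat (M n) * N n))"
proof (intro conjI allI impI)
  fix P Q and M N :: "nat \<Rightarrow> real mat"
  assume PQ: "(P, Q) \<in> {(strictly_lower_part, upper_part), (strictly_upper_part, lower_part)}"
    and s0: "splitting P Q A (M 0) (N 0)"
    and s: "\<forall>i<n. splitting P Q (1\<^sub>m n + inv_mat (N i) * M i) (M (Suc i)) (N (Suc i))"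
    and inv: "\<forall>i\<le>n. invertible_mat (N i)"
  \<comment> \<open>The recursion treats the initial matrix separately; \<open>X\<close> merges both
    cases, with index \<open>Suc j\<close> for the matrix built from step \<open>j\<close>.\<close>
  define X where "X i = (case i of 0 \<Rightarrow> A | Suc j \<Rightarrow> 1\<^sub>m n + inv_mat (N j) * M j)" for i
  have c: "M i \<in> carrier_mat n n \<and> N i \<in> carrier_mat n n" if "i \<le> n" for i
  proof (rule iterated_splitting_carrier[of P Q X n n M N])
    show "splitting P Q (X i) (M i) (N i)" if "i \<le> n" for i
      using s0 s that by (cases i) (auto simp: X_def)
    show "X (Suc i) \<in> carrier_mat n n"
      if "i < n" "M i \<in> carrier_mat n n" "N i \<in> carrier_mat n n" for i
      using that inv inv_mat(1)[of "N i" n] by (simp add: X_def)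
  qed (use PQ assms(1) that in \<open>auto simp: X_def\<close>)
  \<comment> \<open>The invertible summand must come first here, whereas \<open>splitting\<close>
    puts it second in this part; each sum is therefore commuted, which again uses the dimensions
    from \<open>c\<close>.\<close>
  have "N 0 + M 0 = mat_prod_upto n N n * (1\<^sub>m n + inv_mat (N n) * M n)"
  proof (rule iterated_splitting_product)
    show "N (Suc i) + M (Suc i) = 1\<^sub>m n + inv_mat (N i) * M i" if "i < n" for i
      using s that c[of "Suc i"] comm_add_mat[of "N (Suc i)" n n "M (Suc i)"]
      by (auto simp: splitting_def)
  qed (use c inv in auto)
  moreover have "N 0 + M 0 = A"
    using s0 c[of 0] comm_add_mat[of "N 0" n n "M 0"] by (auto simp: splitting_def)
  ultimately show "A = mat_prod_upto n N n * (1\<^sub>m n + inv_mat (N n) * M n)" by simp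
next
  fix P Q and M N :: "nat \<Rightarrow> real mat"
  assume PQ: "(P, Q) \<in> {(lower_part, strictly_upper_part), (upper_part, strictly_lower_part)}"
    and s0: "splitting P Q A (M 0) (N 0)"
    and s: "\<forall>i<n. splitting P Q (1\<^sub>m n + inv_mat (M i) * N i) (M (Suc i)) (N (Suc i))"
    and inv: "\<forall>i\<le>n. invertible_mat (M i)"
  define X where "X i = (case i of 0 \<Rightarrow> A | Suc j \<Rightarrow> 1\<^sub>m n + inv_mat (M j) * N j)" for i
  have c: "M i \<in> carrier_mat n n \<and> N i \<in> carrier_mat n n" if "i \<le> n" for i
  proof (rule iterated_splitting_carrier[of P Q X n n M N])
    show "splitting P Q (X i) (M i) (N i)" if "i \<le> n" for i
      using s0 s that by (cases i) (auto simp: X_def)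
    show "X (Suc i) \<in> carrier_mat n n"
      if "i < n" "M i \<in> carrier_mat n n" "N i \<in> carrier_mat n n" for i
      using that inv inv_mat(1)[of "M i" n] by (simp add: X_def)
  qed (use PQ assms(1) that in \<open>auto simp: X_def\<close>)
  \<comment> \<open>Now the invertible summand \<open>M\<close> already stands first, so the
    splitting equations fit directly.\<close>
  have "M 0 + N 0 = mat_prod_upto n M n * (1\<^sub>m n + inv_mat (M n) * N n)"
    by (rule iterated_splitting_product) (use c inv s in \<open>auto simp: splitting_def\<close>)
  then show "A = mat_prod_upto n M n * (1\<^sub>m n + inv_mat (M n) * N n)"
    using s0 by (simp add: splitting_def)
qed

end
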